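(* Let $g\in\mathcal{C}_{d,n}$. Then $$g=\arg\min_{h\in\mathcal{H}_{d,n}}\left\{\|h\|_{L^2(\mu_g)}\,:\,\|h\|_{L^1(\mu_g)}=\|g\|_{L^1(\mu_g)}\right\}$$ or, equivalently, $$\frac{\|g\|_{L^2(\mu_g)}}{\|g\|_{L^1(\mu_g)}}=\min\left\{\frac{\|h\|_{L^2(\mu_g)}}{\|h\|_{L^1(\mu_g)}}\,:\,h\in\mathcal{H}_{d,n}\setminus\{0\}\right\}.$$ Moreover, up to a (scalar) factor, $g$ is the unique minimizer of these optimization problems.
   Context: $n$ is a positive integer and $d\ge 2$ is even. $\mathcal{H}_{d,n}$ is the space of real $n$-variate forms (homogeneous polynomials) of degree $d$, and $\mathcal{C}_{d,n}\subset\mathcal{H}_{d,n}$ is the set of forms that are strictly positive on $\mathbb{R}^n\setminus\{\mathbf{0}\}$. For $g\in\mathcal{C}_{d,n}$ let $\mathbf{G}=\{\mathbf{x}\in\mathbb{R}^n: g(\mathbf{x})\le 1\}$ and let $\mu_g$ be the Lebesgue measure restricted to $\mathbf{G}$, so that $\|h\|_{L^1(\mu_g)}=\int_{\mathbf{G}}|h(\mathbf{x})|\,\mathrm{d}\mathbf{x}$ and $\|h\|_{L^2(\mu_g)}=\left(\int_{\mathbf{G}}|h(\mathbf{x})|^2\,\mathrm{d}\mathbf{x}\right)^{1/2}$. *)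

theory Defs
  imports "HOL-Analysis.Analysis"
begin

text \<open>
  A form is identified with the function it induces on \<open>\<real>\<^sup>n\<close>; over the infinite field of reals
  this loses no information.
\<close>

definition exponents :: "nat \<Rightarrow> ('n::finite \<Rightarrow> nat) set" where
  "exponents d = {\<alpha>. (\<Sum>i\<in>UNIV. \<alpha> i) = d}"

definition forms :: "nat \<Rightarrow> (real ^ 'n \<Rightarrow> real) set" where
  "forms d = {h. \<exists>c. \<forall>x. h x = (\<Sum>\<alpha>\<in>exponents d. c \<alpha> * (\<Prod>i\<in>UNIV. (x $ i) ^ \<alpha> i))}"

text \<open>The index set of the sum in \<open>forms\<close> is finite, so that sum is never the junk value \<open>0\<close>.\<close>

lemma finite_exponents: "finite (exponents d :: ('n::finite \<Rightarrow> nat) set)"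
proof (rule finite_subset)
  show "exponents d \<subseteq> (\<Pi>\<^sub>E i\<in>(UNIV :: 'n set). {..d})"
    by (auto simp: exponents_def PiE_def intro!: member_le_sum)
  show "finite (\<Pi>\<^sub>E i\<in>(UNIV :: 'n set). {..d})"
    by (rule finite_PiE) auto
qed

definition pos_forms :: "nat \<Rightarrow> (real ^ 'n \<Rightarrow> real) set" where
  "pos_forms d = {g \<in> forms d. \<forall>x. x \<noteq> 0 \<longrightarrow> g x > 0}"

definition sublevel_measure :: "(real ^ 'n \<Rightarrow> real) \<Rightarrow> (real ^ 'n) measure" where
  "sublevel_measure g = lebesgue_on {x. g x \<le> 1}"

text \<open>
  The Bochner integral of a non-integrable function is \<open>0\<close>. The norms below are applied only to
  forms, with respect to the sublevel measure of a positive form of positive degree; its sublevel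
  set is compact, so all these integrals exist.
\<close>

definition L1_norm :: "'a measure \<Rightarrow> ('a \<Rightarrow> real) \<Rightarrow> real" where
  "L1_norm M h = (\<integral>x. \<bar>h x\<bar> \<partial>M)"

definition L2_norm :: "'a measure \<Rightarrow> ('a \<Rightarrow> real) \<Rightarrow> real" where
  "L2_norm M h = sqrt (\<integral>x. \<bar>h x\<bar>\<^sup>2 \<partial>M)"

end

theory Submission
  imports Defs
begin

text \<open>
  Homogeneity makes \<open>\<integral>\<^bsub>g \<le> t\<^esub> f\<close> proportional to \<open>\<integral>\<^bsub>g \<le> 1\<^esub> f\<close>, with a factor depending on \<open>t\<close> only, for
  every nonnegative homogeneous \<open>f\<close> of degree \<open>d\<close>. Integrating over \<open>t\<close> gives a constant \<open>k\<close>
  such that \<open>\<integral>\<^bsub>G\<^esub> \<bar>h\<bar> g = k \<integral>\<^bsub>G\<^esub> \<bar>h\<bar>\<close> for all forms \<open>h\<close>. Thus the \<open>L\<^sup>1\<close> norm of \<open>h\<close> is, up to \<open>k\<close>, the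
  inner product of \<open>\<bar>h\<bar>\<close> with \<open>g\<close>, and the claim is the Cauchy-Schwarz inequality. Its
  equality case gives \<open>\<bar>h\<bar> = c g\<close>, and a form of even degree without zeros outside the
  origin has constant sign.
\<close>

section \<open>Forms as continuous homogeneous functions\<close>

lemma forms_continuous:
  assumes "h \<in> forms d"
  shows "continuous_on S h"
proof -
  obtain c where "\<And>x. h x = (\<Sum>\<alpha>\<in>exponents d. c \<alpha> * (\<Prod>i\<in>UNIV. (x $ i) ^ \<alpha> i))"
    using assms unfolding forms_def by auto
  then have "h = (\<lambda>x. \<Sum>\<alpha>\<in>exponents d. c \<alpha> * (\<Prod>i\<in>UNIV. (x $ i) ^ \<alpha> i))"
    by auto
  then show ?thesis by (auto intro!: continuous_intros)
qed

text \<open>Each monomial contributes the factor \<open>s ^ d\<close>, its exponents summing to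
  \<open>d\<close>. All real \<open>s\<close> are allowed: \<open>s = 0\<close> gives the value at
  the origin, and nonpositive factors occur in the sign argument for even degree.\<close>

lemma forms_scale:
  assumes "h \<in> forms d"
  shows "h (s *\<^sub>R x) = s ^ d * h x"
proof -
  obtain c where h: "\<And>x. h x = (\<Sum>\<alpha>\<in>exponents d. c \<alpha> * (\<Prod>i\<in>UNIV. (x $ i) ^ \<alpha> i))"
    using assms unfolding forms_def by auto
  have "(\<Prod>i\<in>UNIV. ((s *\<^sub>R x) $ i) ^ \<alpha> i) = s ^ d * (\<Prod>i\<in>UNIV. (x $ i) ^ \<alpha> i)"
    if "\<alpha> \<in> exponents d" for \<alpha>
  proof -
    have "(\<Prod>i\<in>UNIV. s ^ \<alpha> i) = s ^ d"
      using that by (simp add: exponents_def power_sum [symmetric])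
    then show ?thesis
      by (simp add: power_mult_distrib prod.distrib)
  qed
  then show ?thesis
    unfolding h by (simp add: sum_distrib_left mult.left_commute)
qed

lemma forms_at_0: "h \<in> forms d \<Longrightarrow> d > 0 \<Longrightarrow> h 0 = 0"
  using forms_scale[of h d 0 0] by (simp add: zero_power)

section \<open>Scaling of sublevel sets and the radial moment\<close>

lemma nn_integral_lborel_scale:
  fixes f :: "'a::euclidean_space \<Rightarrow> ennreal"
  assumes [measurable]: "f \<in> borel_measurable borel" and "s > 0"
  shows "(\<integral>\<^sup>+x. f x \<partial>lborel) = ennreal (s ^ DIM('a)) * (\<integral>\<^sup>+x. f (s *\<^sub>R x) \<partial>lborel)"
proof -
  have "(\<integral>\<^sup>+x. f x \<partial>lborel)
      = (\<integral>\<^sup>+x. f x \<partial>density (distr lborel borel (\<lambda>x. 0 + s *\<^sub>R x)) (\<lambda>_. \<bar>s\<bar> ^ DIM('a)))"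
    using lborel_affine[of s "0 :: 'a"] \<open>s > 0\<close> by simp
  also have "\<dots> = ennreal (s ^ DIM('a)) * (\<integral>\<^sup>+x. f (s *\<^sub>R x) \<partial>lborel)"
    using \<open>s > 0\<close> by (simp add: nn_integral_density nn_integral_distr nn_integral_cmult)
  finally show ?thesis .
qed

text \<open>Dilation by \<open>root d t\<close> maps the sublevel set at level 1 onto the one at
  level \<open>t\<close>. The exponent collects the dimension from the Jacobian and \<open>d\<close>
  from the homogeneity of \<open>f\<close>.\<close>

lemma nn_integral_sublevel_scale:
  fixes f g :: "'a::euclidean_space \<Rightarrow> real"
  assumes [measurable]: "f \<in> borel_measurable borel" "g \<in> borel_measurable borel"
    and f: "\<And>s x. s > 0 \<Longrightarrow> f (s *\<^sub>R x) = s ^ d * f x"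
    and g: "\<And>s x. s > 0 \<Longrightarrow> g (s *\<^sub>R x) = s ^ d * g x"
    and "d > 0" "t > 0"
  shows "(\<integral>\<^sup>+x. ennreal (f x) * indicator {x. g x \<le> t} x \<partial>lborel)
    = ennreal (root d t ^ (DIM('a) + d)) * (\<integral>\<^sup>+x. ennreal (f x) * indicator {x. g x \<le> 1} x \<partial>lborel)"
proof -
  let ?s = "root d t"
  have s: "?s > 0" "?s ^ d = t" using \<open>d > 0\<close> \<open>t > 0\<close> by auto
  have *: "ennreal (f (?s *\<^sub>R x)) * indicator {x. g x \<le> t} (?s *\<^sub>R x)
     = ennreal (?s ^ d) * (ennreal (f x) * indicator {x. g x \<le> 1} x)" for x
  proof -
    have "t * g x \<le> t \<longleftrightarrow> g x \<le> 1" using \<open>t > 0\<close> by simp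
    then show ?thesis using s \<open>t > 0\<close>
      by (auto simp: f g indicator_def ennreal_mult')
  qed
  show ?thesis
    using s
    by (subst nn_integral_lborel_scale[OF _ s(1)])
       (auto simp: * nn_integral_cmult power_add ennreal_mult' mult.assoc)
qed

text \<open>Layer-cake argument: where \<open>g x \<le> 1\<close>, the weight \<open>1 - g x\<close>
  is the length of the set of levels \<open>t\<close> in (0,1] with \<open>g x \<le> t\<close>.
  After Fubini the inner integrals run over sublevel sets, and each is a known multiple of the one
  at level 1. The resulting constant depends on neither \<open>f\<close> nor
  \<open>g\<close>.\<close>

lemma nn_integral_radial_moment:
  fixes f g :: "'a::euclidean_space \<Rightarrow> real"
  assumes [measurable]: "f \<in> borel_measurable borel" "g \<in> borel_measurable borel"
    and f: "\<And>s x. s > 0 \<Longrightarrow> f (s *\<^sub>R x) = s ^ d * f x"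
    and g: "\<And>s x. s > 0 \<Longrightarrow> g (s *\<^sub>R x) = s ^ d * g x" "\<And>x. g x \<ge> 0"
    and "d > 0"
  shows "(\<integral>\<^sup>+x. ennreal (f x) * indicator {x. g x \<le> 1} x * ennreal (1 - g x) \<partial>lborel)
    = (\<integral>\<^sup>+t. indicator {0<..1} t * ennreal (root d t ^ (DIM('a) + d)) \<partial>lborel)
      * (\<integral>\<^sup>+x. ennreal (f x) * indicator {x. g x \<le> 1} x \<partial>lborel)"
proof -
  let ?I = "\<integral>\<^sup>+x. ennreal (f x) * indicator {x. g x \<le> 1} x \<partial>lborel"
  let ?ind = "\<lambda>x t. indicator {0<..1} t * indicator {x. g x \<le> t} x :: ennreal"
  have meas: "(\<lambda>(x, t). ennreal (f x) * ?ind x t) \<in> borel_measurable (lborel \<Otimes>\<^sub>M lborel)"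
    unfolding indicator_def by measurable
  have inner: "ennreal (f x) * indicator {x. g x \<le> 1} x * ennreal (1 - g x)
      = (\<integral>\<^sup>+t. ennreal (f x) * ?ind x t \<partial>lborel)" for x
  proof -
    \<comment> \<open>Level 0 is left out because the scaling lemma needs \<open>t > 0\<close>;
      hence the half-open interval when \<open>g x = 0\<close>. For \<open>g x > 1\<close> the
      closed interval is empty.\<close>
    have "(\<integral>\<^sup>+t. ?ind x t \<partial>lborel) = (\<integral>\<^sup>+t. indicator (if g x = 0 then {0<..1} else {g x..1}) t \<partial>lborel)"
      using g(2)[of x] by (intro nn_integral_cong) (auto simp: indicator_def)
    also have "\<dots> = indicator {x. g x \<le> 1} x * ennreal (1 - g x)"
      by (cases "g x \<le> 1"; cases "g x = 0") simp_all
    finally show ?thesis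
      by (subst nn_integral_cmult) (auto simp: mult.assoc indicator_def)
  qed
  have "(\<integral>\<^sup>+x. ennreal (f x) * indicator {x. g x \<le> 1} x * ennreal (1 - g x) \<partial>lborel)
      = (\<integral>\<^sup>+x. \<integral>\<^sup>+t. ennreal (f x) * ?ind x t \<partial>lborel \<partial>lborel)"
    unfolding inner ..
  also have "\<dots> = (\<integral>\<^sup>+t. \<integral>\<^sup>+x. ennreal (f x) * ?ind x t \<partial>lborel \<partial>lborel)"
    using lborel_pair.Fubini'[OF meas] by simp
  also have "\<dots> = (\<integral>\<^sup>+t. indicator {0<..1} t * ennreal (root d t ^ (DIM('a) + d)) * ?I \<partial>lborel)"
  proof (rule nn_integral_cong)
    fix t :: real
    show "(\<integral>\<^sup>+x. ennreal (f x) * ?ind x t \<partial>lborel)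
        = indicator {0<..1} t * ennreal (root d t ^ (DIM('a) + d)) * ?I"
      using nn_integral_sublevel_scale[OF assms(1,2) f g(1) \<open>d > 0\<close>, of t]
      by (cases "t \<in> {0<..1}") auto
  qed
  also have "\<dots> = (\<integral>\<^sup>+t. indicator {0<..1} t * ennreal (root d t ^ (DIM('a) + d)) \<partial>lborel) * ?I"
    by (rule nn_integral_multc) measurable
  finally show ?thesis .
qed

section \<open>Compactness of the sublevel set and integrals over it\<close>

text \<open>On the unit sphere \<open>g\<close> has a positive minimum \<open>m\<close>; homogeneity
  turns this into \<open>g x \<ge> m * norm x ^ d\<close>, which bounds the sublevel set.\<close>

lemma compact_sublevel_pos_form:
  fixes g :: "real ^ 'n \<Rightarrow> real"
  assumes g: "g \<in> pos_forms d" and "d > 0"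
  shows "compact {x. g x \<le> 1}"
proof -
  have gf: "g \<in> forms d" and pos: "\<And>x. x \<noteq> 0 \<Longrightarrow> g x > 0"
    using g by (auto simp: pos_forms_def)
  obtain b :: "real ^ 'n" where "b \<in> Basis" by (meson ex_in_conv nonempty_Basis)
  then have "b \<in> sphere 0 1" by simp
  then obtain z where z: "z \<in> sphere 0 1" "\<And>y. y \<in> sphere 0 1 \<Longrightarrow> g z \<le> g y"
    using continuous_attains_inf[OF compact_sphere _ forms_continuous[OF gf]] by (metis empty_iff)
  have m: "g z > 0" using z(1) by (intro pos) auto
  have "norm x \<le> root d (1 / g z)" if "g x \<le> 1" for x
  proof (cases "x = 0")
    case False
    then have "g z \<le> g (inverse (norm x) *\<^sub>R x)" by (intro z(2)) simp
    also have "\<dots> = g x / norm x ^ d"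
      by (simp add: forms_scale[OF gf] field_simps)
    also have "\<dots> \<le> 1 / norm x ^ d"
      using that by (intro divide_right_mono) auto
    finally have "norm x ^ d \<le> 1 / g z"
      using m False by (simp add: field_simps)
    then have "root d (norm x ^ d) \<le> root d (1 / g z)"
      using \<open>d > 0\<close> by simp
    then show ?thesis using \<open>d > 0\<close> by (simp add: real_root_power_cancel)
  qed (use m \<open>d > 0\<close> in auto)
  then have "bounded {x. g x \<le> 1}"
    unfolding bounded_iff by blast
  moreover have "closed {x. g x \<le> 1}"
    by (intro closed_Collect_le forms_continuous[OF gf] continuous_intros)
  ultimately show ?thesis by (simp add: compact_eq_bounded_closed)
qed

text \<open>Links the Bochner integrals in the norms to the nonnegative integrals over
  \<open>lborel\<close>, where scaling and Fubini are carried out.\<close>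

lemma lebesgue_on_continuous:
  fixes f :: "'a::euclidean_space \<Rightarrow> real"
  assumes "compact S" and "continuous_on UNIV f"
  shows integrable_lebesgue_on_continuous: "integrable (lebesgue_on S) f"
    and nn_integral_lebesgue_on_continuous: "(\<And>x. x \<in> S \<Longrightarrow> f x \<ge> 0) \<Longrightarrow>
      (\<integral>\<^sup>+x. ennreal (f x) * indicator S x \<partial>lborel) = ennreal (\<integral>x. f x \<partial>lebesgue_on S)"
proof -
  have S: "S \<in> sets borel" "S \<in> sets lebesgue"
    using \<open>compact S\<close> by (simp_all add: borel_compact lmeasurable_compact fmeasurableD)
  have int: "integrable lborel (\<lambda>x. indicator S x *\<^sub>R f x)"
    using borel_integrable_compact[OF \<open>compact S\<close> continuous_on_subset[OF assms(2)]]
    by (simp add: scaleR_conv_of_real indicator_def if_distrib cong: if_cong)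
  then have "integrable lebesgue (\<lambda>x. indicator S x *\<^sub>R f x)"
    by (simp add: integrable_completion)
  then show "integrable (lebesgue_on S) f"
    using S by (simp add: integrable_restrict_space)
  assume nn: "\<And>x. x \<in> S \<Longrightarrow> f x \<ge> 0"
  have "(\<integral>x. f x \<partial>lebesgue_on S) = (\<integral>x. indicator S x *\<^sub>R f x \<partial>lebesgue)"
    using S by (simp add: integral_restrict_space)
  also have "\<dots> = (\<integral>x. indicator S x *\<^sub>R f x \<partial>lborel)"
    using int by (intro integral_completion) auto
  finally have "ennreal (\<integral>x. f x \<partial>lebesgue_on S) = (\<integral>\<^sup>+x. ennreal (indicator S x *\<^sub>R f x) \<partial>lborel)"
    using nn by (subst nn_integral_eq_integral[OF int]) (auto simp: indicator_def)
  also have "\<dots> = (\<integral>\<^sup>+x. ennreal (f x) * indicator S x \<partial>lborel)"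
    by (intro nn_integral_cong) (auto simp: indicator_def)
  finally show "(\<integral>\<^sup>+x. ennreal (f x) * indicator S x \<partial>lborel) = ennreal (\<integral>x. f x \<partial>lebesgue_on S)"
    by simp
qed

lemma integral_radial_moment:
  fixes g :: "real ^ 'n \<Rightarrow> real"
  assumes g: "g \<in> pos_forms d" and "d > 0"
  shows "\<exists>k. \<forall>h\<in>forms d. (\<integral>x. \<bar>h x\<bar> * g x \<partial>sublevel_measure g) = k * L1_norm (sublevel_measure g) h"
proof -
  define K where "K = (\<integral>\<^sup>+t. indicator {0<..1} t * ennreal (root d t ^ (DIM(real ^ 'n) + d)) \<partial>lborel)"
  let ?G = "{x. g x \<le> 1}"
  have gf: "g \<in> forms d" using g by (auto simp: pos_forms_def)
  have nonneg: "g x \<ge> 0" for x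
  proof (cases "x = 0")
    case True
    then show ?thesis using forms_at_0[OF gf \<open>d > 0\<close>] by simp
  qed (use g in \<open>auto simp: pos_forms_def less_imp_le\<close>)
  have G: "compact ?G" by (rule compact_sublevel_pos_form) fact+
  have gc: "continuous_on UNIV g" by (rule forms_continuous[OF gf])
  \<comment> \<open>The radial moment lemma evaluates the weight \<open>1 - g\<close>, so the weight
    \<open>g\<close> gets the factor \<open>1 - K\<close>. With n the dimension, \<open>K\<close> is
    d/(n+2d), but only its independence of \<open>h\<close> matters.\<close>
  have "(\<integral>x. \<bar>h x\<bar> * g x \<partial>lebesgue_on ?G) = (1 - enn2real K) * (\<integral>x. \<bar>h x\<bar> \<partial>lebesgue_on ?G)"
    if h: "h \<in> forms d" for h
  proof -
    have hc: "continuous_on UNIV h" by (rule forms_continuous[OF h])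
    have c: "continuous_on UNIV (\<lambda>x. \<bar>h x\<bar>)" "continuous_on UNIV (\<lambda>x. \<bar>h x\<bar> * g x)"
      "continuous_on UNIV (\<lambda>x. \<bar>h x\<bar> * (1 - g x))"
      by (intro continuous_intros hc gc)+
    have "ennreal (\<integral>x. \<bar>h x\<bar> * (1 - g x) \<partial>lebesgue_on ?G)
        = (\<integral>\<^sup>+x. ennreal \<bar>h x\<bar> * indicator ?G x * ennreal (1 - g x) \<partial>lborel)"
      by (subst nn_integral_lebesgue_on_continuous[OF G c(3), symmetric])
         (auto intro!: nn_integral_cong simp: ennreal_mult indicator_def)
    also have "\<dots> = K * (\<integral>\<^sup>+x. ennreal \<bar>h x\<bar> * indicator ?G x \<partial>lborel)"
      unfolding K_def
      by (rule nn_integral_radial_moment)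
         (use c(1) gc nonneg \<open>d > 0\<close> in \<open>auto simp: forms_scale[OF h] forms_scale[OF gf] abs_mult
            intro: borel_measurable_continuous_onI\<close>)
    also have "(\<integral>\<^sup>+x. ennreal \<bar>h x\<bar> * indicator ?G x \<partial>lborel) = ennreal (\<integral>x. \<bar>h x\<bar> \<partial>lebesgue_on ?G)"
      by (rule nn_integral_lebesgue_on_continuous[OF G c(1)]) simp
    \<comment> \<open>Since \<open>enn2real\<close> is multiplicative even at infinity, the identity
      passes to the reals without a finiteness proof for \<open>K\<close>.\<close>
    finally have "enn2real (ennreal (\<integral>x. \<bar>h x\<bar> * (1 - g x) \<partial>lebesgue_on ?G))
        = enn2real (K * ennreal (\<integral>x. \<bar>h x\<bar> \<partial>lebesgue_on ?G))"
      by simp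
    moreover have "0 \<le> (\<integral>x. \<bar>h x\<bar> * (1 - g x) \<partial>lebesgue_on ?G)"
      by (rule integral_nonneg_AE, rule AE_I2) (auto simp: space_restrict_space)
    ultimately have "(\<integral>x. \<bar>h x\<bar> * (1 - g x) \<partial>lebesgue_on ?G)
        = enn2real K * (\<integral>x. \<bar>h x\<bar> \<partial>lebesgue_on ?G)"
      by (simp add: enn2real_mult)
    moreover have "(\<integral>x. \<bar>h x\<bar> * (1 - g x) \<partial>lebesgue_on ?G)
        = (\<integral>x. \<bar>h x\<bar> \<partial>lebesgue_on ?G) - (\<integral>x. \<bar>h x\<bar> * g x \<partial>lebesgue_on ?G)"
      using integrable_lebesgue_on_continuous[OF G c(1)] integrable_lebesgue_on_continuous[OF G c(2)]
      by (simp add: right_diff_distrib)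
    ultimately show ?thesis by (simp add: algebra_simps)
  qed
  then show ?thesis unfolding sublevel_measure_def L1_norm_def by blast
qed

section \<open>Vanishing integrals and constant sign\<close>

text \<open>The function vanishes almost everywhere on the sublevel set, hence everywhere on the
  open part \<open>g x < 1\<close> by continuity. Every ray meets that part near the origin, and
  homogeneity spreads the zero along the ray. The degree \<open>e\<close> is separate from
  \<open>d\<close> so that squares are covered too.\<close>

lemma homogeneous_eq_0_if_integral_eq_0:
  fixes f g :: "real ^ 'n \<Rightarrow> real"
  assumes g: "g \<in> pos_forms d" and "d > 0"
    and f: "continuous_on UNIV f" "\<And>x. f x \<ge> 0" "\<And>s x. s > 0 \<Longrightarrow> f (s *\<^sub>R x) = s ^ e * f x"
    and zero: "(\<integral>x. f x \<partial>sublevel_measure g) = 0"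
  shows "f x = 0"
proof -
  have gf: "g \<in> forms d" using g by (auto simp: pos_forms_def)
  have gc: "continuous_on UNIV g" by (rule forms_continuous[OF gf])
  \<comment> \<open>The strict inequality makes \<open>?U\<close> open, so being negligible forces
    it to be empty.\<close>
  let ?G = "{x. g x \<le> 1}" and ?U = "{x. g x < 1 \<and> f x > 0}"
  have G: "compact ?G" by (rule compact_sublevel_pos_form) fact+
  have "(\<integral>x. f x \<partial>lebesgue_on ?G) = 0" using zero by (simp add: sublevel_measure_def)
  then have "AE x in lebesgue_on ?G. f x = 0"
    using integral_nonneg_eq_0_iff_AE[OF integrable_lebesgue_on_continuous[OF G f(1)]] f(2) by simp
  then have "AE x in lebesgue. x \<in> ?G \<longrightarrow> f x = 0"
    using G by (subst (asm) AE_restrict_space_iff) (auto simp: lmeasurable_compact fmeasurableD)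
  then have "AE x in lebesgue. x \<notin> ?U"
    by (rule AE_mp) (auto intro!: AE_I2)
  moreover have "open ?U"
    by (intro open_Collect_conj open_Collect_less gc f(1) continuous_intros)
  ultimately have "negligible ?U"
    by (simp add: negligible_iff_null_sets AE_iff_null_sets borel_open)
  with \<open>open ?U\<close> have U: "?U = {}" using open_not_negligible by blast
  \<comment> \<open>The limit is one-sided because \<open>f\<close> is homogeneous for positive
    factors only.\<close>
  have "((\<lambda>s. s ^ d * g x) \<longlongrightarrow> 0 ^ d * g x) (at_right 0)"
    by (intro tendsto_intros)
  then have "((\<lambda>s. g (s *\<^sub>R x)) \<longlongrightarrow> 0) (at_right 0)"
    using \<open>d > 0\<close> by (simp add: forms_scale[OF gf] zero_power)
  then have "eventually (\<lambda>s. g (s *\<^sub>R x) < 1) (at_right 0)"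
    by (rule order_tendstoD) simp
  moreover have "eventually (\<lambda>s::real. s > 0) (at_right 0)"
    by (rule eventually_at_right_less)
  ultimately have "eventually (\<lambda>s. g (s *\<^sub>R x) < 1 \<and> s > 0) (at_right 0)"
    by (rule eventually_conj)
  then obtain s where s: "s > 0" "g (s *\<^sub>R x) < 1"
    using eventually_happens'[OF trivial_limit_at_right_real] by blast
  then have "\<not> f (s *\<^sub>R x) > 0" using U by blast
  then show ?thesis using f(2)[of x] f(3)[OF s(1)] s(1)
    by (metis less_eq_real_def mult_pos_pos zero_less_power)
qed

text \<open>Between a negative and a positive value the segment contains a zero of \<open>h\<close>,
  which must be the origin. So the two points are linearly dependent, where even degree rules out
  opposite signs. This treats dimension one as well, where the complement of the origin is
  disconnected.\<close>

lemma even_form_constant_sign: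
  fixes h :: "real ^ 'n \<Rightarrow> real"
  assumes h: "h \<in> forms d" and "even d" and nz: "\<And>x. x \<noteq> 0 \<Longrightarrow> h x \<noteq> 0"
  shows "(\<forall>x. h x \<ge> 0) \<or> (\<forall>x. h x \<le> 0)"
proof (rule ccontr)
  assume "\<not> ?thesis"
  then obtain x y where xy: "h x < 0" "h y > 0" by (meson not_le)
  let ?p = "\<lambda>s. (1 - s) *\<^sub>R x + s *\<^sub>R y"
  have "continuous_on {0..1} (\<lambda>s. h (?p s))"
    by (rule continuous_on_compose2[OF forms_continuous[OF h]]) (auto intro!: continuous_intros)
  then obtain s where s: "0 \<le> s" "s \<le> 1" "h (?p s) = 0"
    using IVT'[of "\<lambda>s. h (?p s)" 0 0 1] xy by auto
  then have p: "s *\<^sub>R y = (s - 1) *\<^sub>R x" using nz[of "?p s"]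
    by (metis add_eq_0_iff minus_diff_eq scaleR_minus_left)
  then have "s ^ d * h y = (s - 1) ^ d * h x"
    by (metis forms_scale[OF h])
  moreover have "s ^ d * h y \<ge> 0" "(s - 1) ^ d * h x \<le> 0"
    using xy s \<open>even d\<close> by (auto simp: mult_nonneg_nonpos zero_le_even_power)
  \<comment> \<open>Equal quantities of opposite sign are both 0; as \<open>h x\<close> and
    \<open>h y\<close> are nonzero, this would force \<open>s = 0\<close> and \<open>s = 1\<close>
    at once.\<close>
  ultimately have "s ^ d * h y = 0" "(s - 1) ^ d * h x = 0" by linarith+
  then show False using xy by auto
qed

text \<open>Ensures that the quotients of norms are genuine, never the default value 0 of a division
  by zero.\<close>

lemma L1_norm_pos:
  fixes g h :: "real ^ 'n \<Rightarrow> real"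
  assumes g: "g \<in> pos_forms d" and "d > 0" "h \<in> forms d" "h \<noteq> (\<lambda>x. 0)"
  shows "L1_norm (sublevel_measure g) h > 0"
proof -
  have "L1_norm (sublevel_measure g) h \<noteq> 0"
  proof
    assume "L1_norm (sublevel_measure g) h = 0"
    then have "\<bar>h x\<bar> = 0" for x
      unfolding L1_norm_def
      by (intro homogeneous_eq_0_if_integral_eq_0[OF g \<open>d > 0\<close>, of "\<lambda>x. \<bar>h x\<bar>" d])
         (auto simp: forms_scale[OF assms(3)] abs_mult intro!: continuous_intros forms_continuous[OF assms(3)])
    then show False using assms(4) by auto
  qed
  moreover have "L1_norm (sublevel_measure g) h \<ge> 0" by (simp add: L1_norm_def)
  ultimately show ?thesis by simp
qed

lemma pos_form_neq_0:
  fixes g :: "real ^ 'n \<Rightarrow> real"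
  assumes "g \<in> pos_forms d"
  shows "g \<noteq> (\<lambda>x. 0)"
proof
  assume "g = (\<lambda>x. 0)"
  moreover have "g 1 > 0" using assms by (simp add: pos_forms_def)
  ultimately show False by simp
qed

section \<open>Cauchy-Schwarz and its equality case\<close>

text \<open>Comparison of the norm ratios in cross-multiplied form, which includes
  \<open>h = 0\<close> and serves both minimization problems.\<close>

lemma norm_ratio_le:
  fixes g h :: "real ^ 'n \<Rightarrow> real"
  assumes g: "g \<in> pos_forms d" and "even d" "d > 0" and h: "h \<in> forms d"
  defines "\<mu> \<equiv> sublevel_measure g"
  shows "L2_norm \<mu> g * L1_norm \<mu> h \<le> L2_norm \<mu> h * L1_norm \<mu> g"
    and "L2_norm \<mu> g * L1_norm \<mu> h = L2_norm \<mu> h * L1_norm \<mu> g \<Longrightarrow> \<exists>c. h = (\<lambda>x. c * g x)"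
proof -
  have gf: "g \<in> forms d" and pos: "\<And>x. x \<noteq> 0 \<Longrightarrow> g x > 0"
    using g by (auto simp: pos_forms_def)
  have g0: "g 0 = 0" and h0: "h 0 = 0"
    using forms_at_0 gf h \<open>d > 0\<close> by blast+
  have g_nonneg: "\<bar>g x\<bar> = g x" for x using pos[of x] g0 by (cases "x = 0") auto
  note c = forms_continuous[OF gf] forms_continuous[OF h]
  have integrable: "integrable \<mu> f" if "continuous_on UNIV f" for f :: "real ^ 'n \<Rightarrow> real"
    unfolding \<mu>_def sublevel_measure_def
    by (rule integrable_lebesgue_on_continuous[OF compact_sublevel_pos_form[OF g \<open>d > 0\<close>] that])
  \<comment> \<open>These are the entries of the Gram matrix of \<open>\<bar>h\<bar>\<close> and
    \<open>g\<close> in the space of square-integrable functions.\<close>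
  define A B C where "A = (\<integral>x. (h x)\<^sup>2 \<partial>\<mu>)" and "B = (\<integral>x. \<bar>h x\<bar> * g x \<partial>\<mu>)" and "C = (\<integral>x. (g x)\<^sup>2 \<partial>\<mu>)"
  define a b where "a = L1_norm \<mu> h" and "b = L1_norm \<mu> g"
  obtain k where k: "\<And>f. f \<in> forms d \<Longrightarrow> (\<integral>x. \<bar>f x\<bar> * g x \<partial>\<mu>) = k * L1_norm \<mu> f"
    using integral_radial_moment[OF g \<open>d > 0\<close>] unfolding \<mu>_def by blast
  have Bk: "B = k * a" using k[OF h] by (simp add: B_def a_def)
  have Ck: "C = k * b" using k[OF gf] by (simp add: C_def b_def g_nonneg power2_eq_square)
  have "b > 0"
    unfolding b_def \<mu>_def by (rule L1_norm_pos[OF g \<open>d > 0\<close> gf pos_form_neq_0[OF g]])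
  have "C \<noteq> 0"
  proof
    assume "C = 0"
    then have "(g x)\<^sup>2 = 0" for x
      unfolding C_def \<mu>_def
      by (intro homogeneous_eq_0_if_integral_eq_0[OF g \<open>d > 0\<close>, of "\<lambda>x. (g x)\<^sup>2" "2 * d"])
         (auto simp: forms_scale[OF gf] power_mult_distrib power_mult mult.commute intro!: continuous_intros c)
    then show False using pos_form_neq_0[OF g] by auto
  qed
  moreover have "C \<ge> 0" by (simp add: C_def)
  ultimately have "C > 0" by simp
  have "a \<ge> 0" by (simp add: a_def L1_norm_def)
  have k0: "k > 0" using Ck \<open>C > 0\<close> \<open>b > 0\<close> by (simp add: zero_less_mult_iff)
  \<comment> \<open>The squared function is \<open>C\<close> times the component of
    \<open>\<bar>h\<bar>\<close> orthogonal to \<open>g\<close>. The integral of \<open>q\<close>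
    being nonnegative is Cauchy-Schwarz; its vanishing is the equality case.\<close>
  define q where "q = (\<lambda>x. (C * \<bar>h x\<bar> - B * g x)\<^sup>2)"
  have q: "(\<integral>x. q x \<partial>\<mu>) = C * (C * A - B\<^sup>2)"
  proof -
    have "q = (\<lambda>x. C\<^sup>2 * (h x)\<^sup>2 - 2 * C * B * (\<bar>h x\<bar> * g x) + B\<^sup>2 * (g x)\<^sup>2)"
      by (auto simp: q_def power2_eq_square algebra_simps)
    then have "(\<integral>x. q x \<partial>\<mu>) = C\<^sup>2 * A - 2 * C * B * B + B\<^sup>2 * C"
      unfolding A_def B_def C_def
      by (simp add: integrable continuous_intros c)
    then show ?thesis by (simp add: power2_eq_square algebra_simps)
  qed
  moreover have "(\<integral>x. q x \<partial>\<mu>) \<ge> 0" by (simp add: q_def)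
  ultimately have CA: "C * A - B\<^sup>2 \<ge> 0" using \<open>C > 0\<close> by (simp add: zero_le_mult_iff)
  \<comment> \<open>Substituting \<open>B = k * a\<close> and \<open>C = k * b\<close> turns the
    Cauchy-Schwarz defect into the defect of the squared norm inequality.\<close>
  have scale: "k * (A * b\<^sup>2 - C * a\<^sup>2) = (C * A - B\<^sup>2) * b"
    by (simp add: Bk Ck power2_eq_square algebra_simps)
  have norms: "L2_norm \<mu> g = sqrt C" "L2_norm \<mu> h = sqrt A"
    by (simp_all add: L2_norm_def A_def C_def)
  have roots: "L2_norm \<mu> g * a = sqrt (C * a\<^sup>2)" "L2_norm \<mu> h * b = sqrt (A * b\<^sup>2)"
    using \<open>a \<ge> 0\<close> \<open>b > 0\<close> by (simp_all add: norms real_sqrt_mult)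
  have "k * (A * b\<^sup>2 - C * a\<^sup>2) \<ge> 0"
    unfolding scale using CA \<open>b > 0\<close> by simp
  then have "C * a\<^sup>2 \<le> A * b\<^sup>2" using k0 by (simp add: zero_le_mult_iff)
  then show "L2_norm \<mu> g * L1_norm \<mu> h \<le> L2_norm \<mu> h * L1_norm \<mu> g"
    using roots by (simp add: a_def b_def)
  assume "L2_norm \<mu> g * L1_norm \<mu> h = L2_norm \<mu> h * L1_norm \<mu> g"
  then have "C * a\<^sup>2 = A * b\<^sup>2" using roots by (simp add: a_def b_def)
  then have "(\<integral>x. q x \<partial>\<mu>) = 0" using scale q \<open>b > 0\<close> by simp
  then have "q x = 0" for x
    unfolding \<mu>_def
  proof (rule homogeneous_eq_0_if_integral_eq_0[OF g \<open>d > 0\<close>, rotated 3])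
    show "continuous_on UNIV q" unfolding q_def by (intro continuous_intros c)
    show "q x \<ge> 0" for x by (simp add: q_def)
    show "q (s *\<^sub>R x) = s ^ (2 * d) * q x" if "s > 0" for s x
    proof -
      have "C * \<bar>h (s *\<^sub>R x)\<bar> - B * g (s *\<^sub>R x) = s ^ d * (C * \<bar>h x\<bar> - B * g x)"
        using that by (simp add: forms_scale[OF h] forms_scale[OF gf] abs_mult algebra_simps)
      then show ?thesis by (simp add: q_def power_mult_distrib power_mult mult.commute)
    qed
  qed
  then have abs: "\<bar>h x\<bar> = B / C * g x" for x
    using \<open>C > 0\<close> by (simp add: q_def field_simps)
  show "\<exists>c. h = (\<lambda>x. c * g x)"
  \<comment> \<open>For \<open>B = 0\<close> the form \<open>h\<close> is identically zero, so the
    sign lemma cannot be applied.\<close>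
  proof (cases "B = 0")
    case True
    then have "h = (\<lambda>x. 0 * g x)" using abs by auto
    then show ?thesis by blast
  next
    case False
    have "h x \<noteq> 0" if "x \<noteq> 0" for x
      using abs[of x] pos[OF that] False \<open>C > 0\<close> by auto
    from even_form_constant_sign[OF h \<open>even d\<close> this] show ?thesis
    proof
      assume "\<forall>x. h x \<ge> 0"
      then have "h = (\<lambda>x. B / C * g x)" using abs by (metis abs_of_nonneg)
      then show ?thesis by blast
    next
      assume "\<forall>x. h x \<le> 0"
      then have "h = (\<lambda>x. - (B / C) * g x)" using abs by (metis abs_of_nonpos minus_minus mult_minus_left)
      then show ?thesis by blast
    qed
  qed
qed

section \<open>The two minimization problems\<close>

theorem theorem1p9:
  fixes g :: "real ^ 'n \<Rightarrow> real" and d :: nat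
  assumes "d \<ge> 2" and "even d" and "g \<in> pos_forms d"
  defines "\<mu> \<equiv> sublevel_measure g"
  shows
    "is_arg_min (L2_norm \<mu>) (\<lambda>h. h \<in> forms d \<and> L1_norm \<mu> h = L1_norm \<mu> g) g
     \<and> is_arg_min (\<lambda>h. L2_norm \<mu> h / L1_norm \<mu> h) (\<lambda>h. h \<in> forms d - {\<lambda>x. 0}) g
     \<and> (\<forall>h. is_arg_min (L2_norm \<mu>) (\<lambda>h. h \<in> forms d \<and> L1_norm \<mu> h = L1_norm \<mu> g) h
            \<longrightarrow> (\<exists>c. h = (\<lambda>x. c * g x)))
     \<and> (\<forall>h. is_arg_min (\<lambda>h. L2_norm \<mu> h / L1_norm \<mu> h) (\<lambda>h. h \<in> forms d - {\<lambda>x. 0}) h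
            \<longrightarrow> (\<exists>c. h = (\<lambda>x. c * g x)))"
proof -
  have d: "d > 0" using \<open>d \<ge> 2\<close> by simp
  have gf: "g \<in> forms d" and g0: "g \<noteq> (\<lambda>x. 0)"
    using assms(3) pos_form_neq_0 by (auto simp: pos_forms_def)
  have pos: "L1_norm \<mu> h > 0" if "h \<in> forms d" "h \<noteq> (\<lambda>x. 0)" for h
    unfolding \<mu>_def by (rule L1_norm_pos) fact+
  note le = norm_ratio_le(1)[OF assms(3,2) d, folded \<mu>_def]
  note eq = norm_ratio_le(2)[OF assms(3,2) d, folded \<mu>_def]
  have ratio: "L2_norm \<mu> g / L1_norm \<mu> g \<le> L2_norm \<mu> h / L1_norm \<mu> h"
    if "h \<in> forms d" "h \<noteq> (\<lambda>x. 0)" for h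
    using le[OF that(1)] pos[OF that] pos[OF gf g0] by (simp add: field_simps)
  have norm: "L2_norm \<mu> g \<le> L2_norm \<mu> h" if "h \<in> forms d" "L1_norm \<mu> h = L1_norm \<mu> g" for h
    using le[OF that(1)] that(2) pos[OF gf g0] by simp
  show ?thesis
  proof (intro conjI allI impI)
    show "is_arg_min (L2_norm \<mu>) (\<lambda>h. h \<in> forms d \<and> L1_norm \<mu> h = L1_norm \<mu> g) g"
      using norm gf by (auto simp: is_arg_min_def not_less)
    show "is_arg_min (\<lambda>h. L2_norm \<mu> h / L1_norm \<mu> h) (\<lambda>h. h \<in> forms d - {\<lambda>x. 0}) g"
      using ratio gf g0 by (auto simp: is_arg_min_def not_less)
  next
    fix h
    assume h: "is_arg_min (L2_norm \<mu>) (\<lambda>h. h \<in> forms d \<and> L1_norm \<mu> h = L1_norm \<mu> g) h"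
    then have "h \<in> forms d" "L1_norm \<mu> h = L1_norm \<mu> g" "L2_norm \<mu> h \<le> L2_norm \<mu> g"
      using gf by (auto simp: is_arg_min_def not_less)
    \<comment> \<open>Both \<open>h\<close> and \<open>g\<close> are minimizers, so their norms
      agree and the equality case applies.\<close>
    with norm have "L2_norm \<mu> g * L1_norm \<mu> h = L2_norm \<mu> h * L1_norm \<mu> g"
      by (simp add: order_antisym)
    then show "\<exists>c. h = (\<lambda>x. c * g x)" using eq \<open>h \<in> forms d\<close> by blast
  next
    fix h
    assume "is_arg_min (\<lambda>h. L2_norm \<mu> h / L1_norm \<mu> h) (\<lambda>h. h \<in> forms d - {\<lambda>x. 0}) h"
    then have h: "h \<in> forms d" "h \<noteq> (\<lambda>x. 0)"
      and "L2_norm \<mu> h / L1_norm \<mu> h \<le> L2_norm \<mu> g / L1_norm \<mu> g"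
      using gf g0 by (auto simp: is_arg_min_def not_less)
    with ratio have "L2_norm \<mu> g / L1_norm \<mu> g = L2_norm \<mu> h / L1_norm \<mu> h"
      by (simp add: order_antisym)
    then have "L2_norm \<mu> g * L1_norm \<mu> h = L2_norm \<mu> h * L1_norm \<mu> g"
      using pos[OF h] pos[OF gf g0] by (simp add: field_simps)
    then show "\<exists>c. h = (\<lambda>x. c * g x)" using eq h(1) by blast
  qed
qed

end
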